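(* Let $k\ge 1$ be an integer and let $A,B$ be real numbers with $A\neq 1$ and $B\ne 0$. The solution $(z_n)_{n\ge 0}$ of $$z_{n+k}=\frac{z_n}{A+Bz_n},\qquad n\ge 0,$$ is $1$-periodic if and only if the initial conditions $z_j$, $j=0,\dots,k-1$, satisfy $z_j=\dfrac{1-A}{B}$.
   Context: A solution is a real sequence $(z_n)_{n\ge 0}$ satisfying the recurrence for all $n\ge 0$ with all denominators $A+Bz_n$ nonzero. A sequence is $1$-periodic if $z_{n+1}=z_n$ for all $n\ge 0$, i.e. it is constant.
   Formalization: The solution is additionally assumed not to be identically zero, since for A ≠ 0 the zero solution is 1-periodic although its initial conditions z_j = 0 differ from (1-A)/B (e.g. k=1, A=2, B=1). *)

theory Defs
  imports Complex_Main
begin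

(* In HOL x / 0 = 0, so the nonvanishing of all denominators is part of the definition. *)
definition is_solution :: "nat \<Rightarrow> real \<Rightarrow> real \<Rightarrow> (nat \<Rightarrow> real) \<Rightarrow> bool" where
  "is_solution k A B z \<longleftrightarrow>
     (\<forall>n. A + B * z n \<noteq> 0 \<and> z (n + k) = z n / (A + B * z n))"

definition one_periodic :: "(nat \<Rightarrow> real) \<Rightarrow> bool" where
  "one_periodic z \<longleftrightarrow> (\<forall>n. z (n + 1) = z n)"

(* For A not 0 the zero sequence is a constant solution for which the stated equivalence
   fails, because (1 - A) / B is not 0 when A is not 1.  It is the only exception among the
   constant solutions and is excluded by this predicate; individual zero terms remain allowed. *)
definition nontrivial :: "(nat \<Rightarrow> real) \<Rightarrow> bool" where
  "nontrivial z \<longleftrightarrow> (\<exists>n. z n \<noteq> 0)"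

end

theory Submission
  imports Defs
begin

text \<open>
  The constant \<open>c = (1 - A) / B\<close> is the value at which the denominator \<open>A + B * c\<close> equals 1, so it
  is a fixed point of \<open>x \<mapsto> x / (A + B * x)\<close>. A block of \<open>k\<close> consecutive terms equal to \<open>c\<close>
  therefore reproduces itself, and the whole sequence is constant. Conversely, the value of a
  constant solution is a fixed point of this map, and 0 and \<open>c\<close> are the only candidates;
  nontriviality rules out 0.
\<close>

lemma one_periodic_iff_constant: "one_periodic z \<longleftrightarrow> (\<forall>n. z n = z 0)"
proof
  assume step: "one_periodic z"
  show "\<forall>n. z n = z 0"
  proof
    fix n
    show "z n = z 0"
      using step by (induction n) (simp_all add: one_periodic_def)
  qed
qed (metis one_periodic_def)

lemma nonzero_fixed_point_iff:
  fixes A B x :: real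
  assumes "B \<noteq> 0" and "x \<noteq> 0" and "A + B * x \<noteq> 0"
  shows "x / (A + B * x) = x \<longleftrightarrow> x = (1 - A) / B"
proof -
  have "x / (A + B * x) = x \<longleftrightarrow> A + B * x = 1"
    using assms by (simp add: divide_eq_eq)
  also have "\<dots> \<longleftrightarrow> x = (1 - A) / B"
    using assms by (auto simp: field_simps)
  finally show ?thesis .
qed

text \<open>
  The recurrence reaches back \<open>k\<close> terms, so the value spreads from the initial block by strong
  induction; \<open>k \<ge> 1\<close> makes the earlier index \<open>n - k\<close> strictly smaller than \<open>n\<close>.
\<close>

lemma solution_constant_from_initial_block:
  assumes sol: "is_solution k A B z" and "k \<ge> 1" and "B \<noteq> 0"
    and init: "\<forall>j<k. z j = (1 - A) / B"
  shows "z n = (1 - A) / B"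
proof (induction n rule: less_induct)
  case (less n)
  show ?case
  proof (cases "n < k")
    case True
    then show ?thesis using init by blast
  next
    case False
    then have prev: "z (n - k) = (1 - A) / B"
      using less \<open>k \<ge> 1\<close> by simp
    then have "A + B * z (n - k) = 1"
      using \<open>B \<noteq> 0\<close> by simp
    moreover have "z (n - k + k) = z (n - k) / (A + B * z (n - k))"
      using sol unfolding is_solution_def by blast
    ultimately show ?thesis
      using False prev by simp
  qed
qed

theorem theorem2p2:
  fixes k :: nat and A B :: real and z :: "nat \<Rightarrow> real"
  assumes "k \<ge> 1" and "A \<noteq> 1" and "B \<noteq> 0"
    and "is_solution k A B z"
    and "nontrivial z"
  shows "one_periodic z \<longleftrightarrow> (\<forall>j<k. z j = (1 - A) / B)"
proof
  assume "one_periodic z"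
  then have const: "z n = z 0" for n
    using one_periodic_iff_constant by blast
  have "z 0 \<noteq> 0"
    using \<open>nontrivial z\<close> const unfolding nontrivial_def by metis
  moreover have "A + B * z 0 \<noteq> 0" and "z 0 / (A + B * z 0) = z 0"
    using \<open>is_solution k A B z\<close> const unfolding is_solution_def by metis+
  ultimately have "z 0 = (1 - A) / B"
    using nonzero_fixed_point_iff \<open>B \<noteq> 0\<close> by blast
  then show "\<forall>j<k. z j = (1 - A) / B"
    using const by simp
next
  assume "\<forall>j<k. z j = (1 - A) / B"
  then have "z n = (1 - A) / B" for n
    using solution_constant_from_initial_block assms by blast
  then show "one_periodic z"
    by (simp add: one_periodic_def)
qed

end
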